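(* Let $(X,T)$ be a POD system. Then $Prox(T^r,T^s)=X^2$ for all $r,s\in\mathbb{N}$ with $r\neq s$.
   Context: A dynamical system $(X,T)$ is a compact metric space $(X,\rho)$ with a continuous map $T\colon X\to X$; it is invertible if $T$ is a homeomorphism. $\mathbb{N}$ is the set of positive integers. For $r,s\in\mathbb{N}$, $Prox(T^r,T^s)=\{(x,y)\in X^2\colon\liminf_{n\to\infty}\rho(T^{rn}x,T^{sn}y)=0\}$; $x$ and $y$ are proximal if $(x,y)\in Prox(T,T)$. An invertible dynamical system $(X,T)$ is a POD (proximal orbit dense) system if it is totally minimal (i.e. $(X,T^n)$ is minimal for every $n\in\mathbb{N}$) and whenever $x,y\in X$ with $x\neq y$, then for some integer $n\neq0$, $T^ny$ is proximal to $x$. *)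

theory Defs
  imports "HOL-Analysis.Analysis"
begin

text \<open>A compact metric space is a compact subset \<open>X\<close> of a metric space type; a self-map of it is
  a function \<open>T\<close> on that type, whose values off \<open>X\<close> play no role.\<close>

definition dynamical_system :: "'a::metric_space set \<Rightarrow> ('a \<Rightarrow> 'a) \<Rightarrow> bool" where
  "dynamical_system X T \<longleftrightarrow> compact X \<and> continuous_on X T \<and> T \<in> X \<rightarrow> X"

definition invertible_system :: "'a::metric_space set \<Rightarrow> ('a \<Rightarrow> 'a) \<Rightarrow> bool" where
  "invertible_system X T \<longleftrightarrow> dynamical_system X T \<and> (\<exists>S. homeomorphism X X T S)"

definition minimal_system :: "'a::metric_space set \<Rightarrow> ('a \<Rightarrow> 'a) \<Rightarrow> bool" where
  "minimal_system X T \<longleftrightarrow> dynamical_system X T \<and>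
     (\<forall>F. F \<subseteq> X \<and> closed F \<and> F \<noteq> {} \<and> T ` F \<subseteq> F \<longrightarrow> F = X)"

definition totally_minimal :: "'a::metric_space set \<Rightarrow> ('a \<Rightarrow> 'a) \<Rightarrow> bool" where
  "totally_minimal X T \<longleftrightarrow> (\<forall>n::nat. n \<ge> 1 \<longrightarrow> minimal_system X (T ^^ n))"

text \<open>\<open>Prox X T r s\<close> is $Prox(T^r,T^s)$. The distances are embedded into the extended reals
  because \<open>liminf\<close> lives on complete lattices.\<close>

definition Prox :: "'a::metric_space set \<Rightarrow> ('a \<Rightarrow> 'a) \<Rightarrow> nat \<Rightarrow> nat \<Rightarrow> ('a \<times> 'a) set" where
  "Prox X T r s = {(x, y) \<in> X \<times> X.
     liminf (\<lambda>n. ereal (dist ((T ^^ (r * n)) x) ((T ^^ (s * n)) y))) = 0}"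

definition proximal :: "'a::metric_space set \<Rightarrow> ('a \<Rightarrow> 'a) \<Rightarrow> 'a \<Rightarrow> 'a \<Rightarrow> bool" where
  "proximal X T x y \<longleftrightarrow> (x, y) \<in> Prox X T 1 1"

text \<open>Integer powers of a bijection \<open>T\<close> of \<open>X\<close>; the inverse is taken relative to \<open>X\<close>, since
  \<open>T\<close> need not be injective off \<open>X\<close>.\<close>

definition int_iterate :: "'a set \<Rightarrow> ('a \<Rightarrow> 'a) \<Rightarrow> int \<Rightarrow> 'a \<Rightarrow> 'a" where
  "int_iterate X T n = (if n \<ge> 0 then T ^^ nat n else inv_into X T ^^ nat (- n))"

definition POD_system :: "'a::metric_space set \<Rightarrow> ('a \<Rightarrow> 'a) \<Rightarrow> bool" where
  "POD_system X T \<longleftrightarrow> invertible_system X T \<and> totally_minimal X T \<and>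
     (\<forall>x\<in>X. \<forall>y\<in>X. x \<noteq> y \<longrightarrow> (\<exists>n::int. n \<noteq> 0 \<and> proximal X T (int_iterate X T n y) x))"

end

theory Submission
  imports Defs
begin

text \<open>
  Every closed subset of \<open>X \<times> X\<close> invariant under \<open>S = T\<^sup>r \<times> T\<^sup>s\<close> contains a minimal one, so it
  suffices that a minimal set \<open>M\<close> of \<open>S\<close> meets the diagonal. If \<open>g\<close> commutes with \<open>S\<close> and the orbits
  of \<open>p\<close> and \<open>g q\<close> under \<open>S\<close> come arbitrarily close to each other for some \<open>p, q \<in> M\<close>, then
  \<open>g M = M\<close>. Take \<open>(x, y) \<in> M\<close> and \<open>(T x, y') \<in> M\<close>; the POD property makes \<open>y\<close> proximal to
  \<open>T\<^sup>n y'\<close> for some integer \<open>n\<close>, hence \<open>T\<inverse> \<times> T\<^sup>n\<close> preserves \<open>M\<close>. Together with \<open>S\<close> this shows that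
  \<open>id \<times> T\<^sup>c\<close> preserves \<open>M\<close> for \<open>c = rn + s\<close>. If \<open>c \<noteq> 0\<close>, minimality of \<open>T\<^sup>c\<close> forces
  \<open>{x} \<times> X \<subseteq> M\<close>. So if \<open>M\<close> misses the diagonal, then \<open>r\<close> divides \<open>s\<close>, and, exchanging the
  coordinates, \<open>s\<close> divides \<open>r\<close>.
\<close>

section \<open>Minimal sets\<close>

lemma minimal_systemD:
  assumes "minimal_system X T"
  shows "compact X" "continuous_on X T" "T ` X \<subseteq> X"
  using assms unfolding minimal_system_def dynamical_system_def by blast+

lemma minimal_systemI:
  assumes "compact X" "continuous_on X T" "T ` X \<subseteq> X"
    and "\<And>F. F \<subseteq> X \<Longrightarrow> closed F \<Longrightarrow> F \<noteq> {} \<Longrightarrow> T ` F \<subseteq> F \<Longrightarrow> F = X"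
  shows "minimal_system X T"
  unfolding minimal_system_def dynamical_system_def
  using assms(1-3) by (intro conjI allI impI assms(4)) (simp_all add: image_subset_iff_funcset)

lemma minimal_system_eqI:
  assumes "minimal_system X T" "F \<subseteq> X" "closed F" "F \<noteq> {}" "T ` F \<subseteq> F"
  shows "F = X"
  using assms unfolding minimal_system_def by blast

text \<open>Zorn's lemma for nonempty closed invariant subsets under reverse inclusion. Compactness
  supplies the bound: the intersection of a chain stays nonempty.\<close>

lemma exists_minimal_subsystem:
  fixes f :: "'a::metric_space \<Rightarrow> 'a"
  assumes K: "dynamical_system K f" and "K \<noteq> {}"
  shows "\<exists>M\<subseteq>K. M \<noteq> {} \<and> minimal_system M f"
proof -
  define A where "A = {F. F \<subseteq> K \<and> closed F \<and> F \<noteq> {} \<and> f ` F \<subseteq> F}"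
  have cK: "compact K" "continuous_on K f" "f ` K \<subseteq> K"
    using K by (auto simp: dynamical_system_def)
  have "\<exists>M\<in>A. \<forall>F\<in>A. F \<subseteq> M \<longrightarrow> F = M"
  proof (rule predicate_Zorn[where P = "\<lambda>E F. F \<subseteq> E"])
    show "partial_order_on A (relation_of (\<lambda>E F. F \<subseteq> E) A)"
      by (auto simp: partial_order_on_def preorder_on_def relation_of_def refl_on_def trans_def antisym_def)
    fix C assume C: "C \<in> Chains (relation_of (\<lambda>E F. F \<subseteq> E) A)"
    have CA: "C \<subseteq> A" and chain: "\<And>E F. E \<in> C \<Longrightarrow> F \<in> C \<Longrightarrow> E \<subseteq> F \<or> F \<subseteq> E"
      using C by (auto simp: Chains_def relation_of_def)
    show "\<exists>u\<in>A. \<forall>F\<in>C. u \<subseteq> F"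
    proof (cases "C = {}")
      \<comment> \<open>The intersection of the empty chain is \<open>UNIV\<close>, so
        \<open>K\<close> itself serves as the bound.\<close>
      case True
      then show ?thesis
        using cK \<open>K \<noteq> {}\<close> by (auto simp: A_def intro!: bexI[of _ K] compact_imp_closed)
    next
      case False
      \<comment> \<open>A finite nonempty subfamily of a chain has a least member, which is its
        intersection. This yields the finite intersection property.\<close>
      have fin: "\<Inter>D \<in> C" if "finite D" "D \<noteq> {}" "D \<subseteq> C" for D
        using that
      proof (induction D rule: finite_ne_induct)
        case (insert F D)
        then have "F \<inter> \<Inter>D = F \<or> F \<inter> \<Inter>D = \<Inter>D" using chain[of F "\<Inter>D"] by blast
        with insert show ?case by auto
      qed simp
      have "K \<inter> \<Inter>C \<noteq> {}"
      proof (rule compact_imp_fip[OF cK(1)])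
        show "closed F" if "F \<in> C" for F using that CA by (auto simp: A_def)
        show "K \<inter> \<Inter>D \<noteq> {}" if D: "finite D" "D \<subseteq> C" for D
        proof (cases "D = {}")
          case True
          then show ?thesis using \<open>K \<noteq> {}\<close> by simp
        next
          case False
          then have "\<Inter>D \<in> A" using fin D CA by blast
          then show ?thesis by (auto simp: A_def)
        qed
      qed
      then have "\<Inter>C \<noteq> {}" by blast
      have "\<Inter>C \<subseteq> K" using False CA by (auto simp: A_def)
      moreover have "closed (\<Inter>C)" using CA by (auto simp: A_def)
      moreover have "f ` F \<subseteq> F" if "F \<in> C" for F using that CA by (auto simp: A_def)
      then have "f ` \<Inter>C \<subseteq> \<Inter>C" by blast
      ultimately have "\<Inter>C \<in> A" unfolding A_def using \<open>\<Inter>C \<noteq> {}\<close> by blast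
      then show ?thesis by blast
    qed
  qed
  then obtain M where M: "M \<in> A" "\<And>F. F \<in> A \<Longrightarrow> F \<subseteq> M \<Longrightarrow> F = M" by blast
  have "M \<subseteq> K" "closed M" "M \<noteq> {}" "f ` M \<subseteq> M" using M(1) by (auto simp: A_def)
  moreover have "compact M"
    using \<open>M \<subseteq> K\<close> \<open>closed M\<close> cK(1) by (metis compact_Int_closed inf.absorb2)
  moreover have "continuous_on M f" using cK(2) \<open>M \<subseteq> K\<close> continuous_on_subset by blast
  moreover have "F = M" if "F \<subseteq> M" "closed F" "F \<noteq> {}" "f ` F \<subseteq> F" for F
    using M(2)[of F] that \<open>M \<subseteq> K\<close> by (auto simp: A_def)
  ultimately have "minimal_system M f" by (intro minimal_systemI)
  with \<open>M \<subseteq> K\<close> \<open>M \<noteq> {}\<close> show ?thesis by blast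
qed

text \<open>By compactness the distance between \<open>M\<close> and \<open>g\<close>
  M\<open>is attained, and\<close>near\<open>makes it zero, so the two sets meet. Since\<close>g\<open>commutes with\<close>f\<open>, the points of\<close>M\<open>that\<close>g\<open>keeps in\<close>M\<open>form a closed invariant set, hence all of\<close>M\<open>. Then\<close>g
  \<open>M\<close> is itself a closed invariant subset of \<open>M\<close>, and minimality applies
  once more.\<close>

lemma minimal_system_image_eq:
  fixes f g :: "'a::metric_space \<Rightarrow> 'a"
  assumes M: "minimal_system M f" and g: "continuous_on M g"
    and comm: "\<And>p. p \<in> M \<Longrightarrow> f (g p) = g (f p)"
    and near: "\<And>e. e > 0 \<Longrightarrow> \<exists>p\<in>M. \<exists>q\<in>M. dist p (g q) < e"
  shows "g ` M = M"
proof -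
  have cM: "compact M" "closed M" "f ` M \<subseteq> M"
    using minimal_systemD[OF M] compact_imp_closed by blast+
  have cg: "compact (g ` M)" using cM g compact_continuous_image by blast
  have "M \<noteq> {}" using near[of 1] by auto
  have "compact (M \<times> g ` M)" using cM(1) cg compact_Times by blast
  moreover have "continuous_on (M \<times> g ` M) (\<lambda>w. dist (fst w) (snd w))"
    by (intro continuous_intros)
  moreover have "M \<times> g ` M \<noteq> {}" using \<open>M \<noteq> {}\<close> by simp
  ultimately obtain z where z: "z \<in> M \<times> g ` M"
    "\<And>w. w \<in> M \<times> g ` M \<Longrightarrow> dist (fst z) (snd z) \<le> dist (fst w) (snd w)"
    using continuous_attains_inf[of "M \<times> g ` M" "\<lambda>w. dist (fst w) (snd w)"] by blast
  have "fst z = snd z"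
  proof (rule ccontr)
    assume "fst z \<noteq> snd z"
    then obtain p q where "p \<in> M" "q \<in> M" "dist p (g q) < dist (fst z) (snd z)"
      using near[of "dist (fst z) (snd z)"] by auto
    then show False using z(2)[of "(p, g q)"] by simp
  qed
  then have ne: "M \<inter> g -` M \<noteq> {}" using z(1) by auto
  have "M \<inter> g -` M = M"
  proof (rule minimal_system_eqI[OF M _ _ ne])
    show "closed (M \<inter> g -` M)" using g cM(2) continuous_closed_preimage by blast
    show "f ` (M \<inter> g -` M) \<subseteq> M \<inter> g -` M"
    proof
      fix w assume "w \<in> f ` (M \<inter> g -` M)"
      then obtain p where p: "p \<in> M" "g p \<in> M" "w = f p" by blast
      then have "g w \<in> M" using comm[OF p(1)] cM(3) by (metis image_subset_iff)
      then show "w \<in> M \<inter> g -` M" using p cM(3) by blast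
    qed
  qed auto
  then have sub: "g ` M \<subseteq> M" by blast
  show ?thesis
  proof (rule minimal_system_eqI[OF M sub])
    show "closed (g ` M)" using cg compact_imp_closed by blast
    show "g ` M \<noteq> {}" using ne by blast
    show "f ` g ` M \<subseteq> g ` M" using cM(3) by (auto simp: comm)
  qed
qed

text \<open>Lets the divisibility argument below be repeated with the two exponents
  exchanged.\<close>

lemma minimal_system_swap:
  assumes M: "minimal_system M (map_prod f g)"
  shows "minimal_system (prod.swap ` M) (map_prod g f)"
proof -
  let ?N = "prod.swap ` M"
  have sw: "map_prod g f = prod.swap \<circ> map_prod f g \<circ> prod.swap" by auto
  have csw: "continuous_on A prod.swap" for A :: "('x::topological_space \<times> 'y::topological_space) set"
    unfolding prod.swap_def by (intro continuous_intros)
  note cM = minimal_systemD[OF M]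
  have "compact ?N" using cM(1) csw compact_continuous_image by blast
  moreover have "continuous_on ?N (map_prod g f)"
    unfolding sw using cM(2) by (intro continuous_on_compose csw) (simp add: image_comp)
  moreover have "map_prod g f ` ?N \<subseteq> ?N"
    using cM(3) by force
  moreover have "F = ?N" if F: "F \<subseteq> ?N" "closed F" "F \<noteq> {}" "map_prod g f ` F \<subseteq> F" for F
  proof -
    have "compact F" using \<open>compact ?N\<close> F by (metis compact_Int_closed inf.absorb2)
    then have "closed (prod.swap ` F)"
      using csw compact_continuous_image compact_imp_closed by blast
    moreover have "prod.swap ` F \<subseteq> M" using F(1) by auto
    moreover have "map_prod f g ` prod.swap ` F \<subseteq> prod.swap ` F"
      using F(4) by force
    ultimately have "prod.swap ` F = M" using minimal_system_eqI[OF M] F(3) by blast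
    then show ?thesis by (auto simp: image_comp)
  qed
  ultimately show ?thesis
    by (intro minimal_systemI)
qed

section \<open>Integer iterates\<close>

text \<open>Tail infima of distances are nonnegative, so their supremum is zero exactly when each of
  them is.\<close>

lemma liminf_dist_eq_0_iff:
  "liminf (\<lambda>n. ereal (dist (u n) (v n))) = 0 \<longleftrightarrow> (\<forall>e>0. \<forall>N. \<exists>n\<ge>N. dist (u n) (v n) < e)"
proof
  assume L: "liminf (\<lambda>n. ereal (dist (u n) (v n))) = 0"
  show "\<forall>e>0. \<forall>N. \<exists>n\<ge>N. dist (u n) (v n) < e"
  proof (intro allI impI)
    fix e :: real and N :: nat assume "e > 0"
    have "(INF n\<in>{N..}. ereal (dist (u n) (v n))) \<le> 0"
      using L SUP_upper[of N UNIV "\<lambda>N. INF n\<in>{N..}. ereal (dist (u n) (v n))"]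
      by (simp add: liminf_SUP_INF)
    also have "\<dots> < ereal e" using \<open>e > 0\<close> by simp
    finally show "\<exists>n\<ge>N. dist (u n) (v n) < e" by (auto simp: INF_less_iff)
  qed
next
  assume R: "\<forall>e>0. \<forall>N. \<exists>n\<ge>N. dist (u n) (v n) < e"
  have "(INF n\<in>{N..}. ereal (dist (u n) (v n))) = 0" for N
  proof (rule antisym)
    show "(INF n\<in>{N..}. ereal (dist (u n) (v n))) \<le> 0"
    proof (rule ereal_le_epsilon2)
      fix e :: real assume "e > 0"
      then obtain n where "n \<ge> N" "dist (u n) (v n) < e" using R by blast
      then show "(INF n\<in>{N..}. ereal (dist (u n) (v n))) \<le> 0 + ereal e"
        by (intro INF_lower2[of n]) auto
    qed
  qed (auto intro: INF_greatest)
  then show "liminf (\<lambda>n. ereal (dist (u n) (v n))) = 0"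
    by (simp add: liminf_SUP_INF)
qed

section \<open>Natural iterates and their equicontinuity\<close>

lemma funpow_mem: "f ` A \<subseteq> A \<Longrightarrow> x \<in> A \<Longrightarrow> (f ^^ n) x \<in> A"
  by (induction n) auto

lemma continuous_on_funpow:
  assumes "continuous_on A f" "f ` A \<subseteq> A"
  shows "continuous_on A (f ^^ n)"
proof (induction n)
  case 0
  show ?case by (simp add: id_def)
next
  case (Suc n)
  have "(f ^^ n) ` A \<subseteq> A" using funpow_mem[OF assms(2)] by blast
  with Suc show ?case
    using assms(1) continuous_on_compose continuous_on_subset by (metis funpow.simps(2))
qed

lemma map_prod_funpow:
  fixes f :: "'a \<Rightarrow> 'a" and g :: "'b \<Rightarrow> 'b"
  shows "map_prod f g ^^ n = map_prod (f ^^ n) (g ^^ n)"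
proof (induction n)
  case 0
  show ?case by (simp add: map_prod.id)
next
  case (Suc n)
  show ?case by (auto simp: fun_eq_iff Suc)
qed

text \<open>Only finitely many iterates occur, each uniformly continuous on \<open>A\<close>. Used
  to delay a close approach by a bounded time without losing it.\<close>

lemma compact_funpow_equicontinuous:
  fixes f :: "'a::metric_space \<Rightarrow> 'a"
  assumes "compact A" "continuous_on A f" "f ` A \<subseteq> A" "e > 0"
  shows "\<exists>d>0. \<forall>x\<in>A. \<forall>y\<in>A. dist x y < d \<longrightarrow> (\<forall>i\<le>n. dist ((f ^^ i) x) ((f ^^ i) y) < e)"
proof (induction n)
  case 0
  show ?case using \<open>e > 0\<close> by auto
next
  case (Suc n)
  then obtain d where d: "d > 0"
    "\<And>x y i. x \<in> A \<Longrightarrow> y \<in> A \<Longrightarrow> dist x y < d \<Longrightarrow> i \<le> n \<Longrightarrow> dist ((f ^^ i) x) ((f ^^ i) y) < e"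
    by blast
  have "uniformly_continuous_on A (f ^^ Suc n)"
    using assms continuous_on_funpow compact_uniformly_continuous by blast
  then obtain d' where d': "d' > 0"
    "\<And>x y. x \<in> A \<Longrightarrow> y \<in> A \<Longrightarrow> dist x y < d' \<Longrightarrow> dist ((f ^^ Suc n) x) ((f ^^ Suc n) y) < e"
    using \<open>e > 0\<close> unfolding uniformly_continuous_on_def by (metis dist_commute)
  show ?case
    using d d' by (intro exI[of _ "min d d'"]) (auto simp: le_Suc_eq)
qed

section \<open>Integer powers of a homeomorphism and their products\<close>

locale homeomorphism_system =
  fixes X :: "'a::metric_space set" and T :: "'a \<Rightarrow> 'a"
  assumes inv_sys: "invertible_system X T"
begin

abbreviation iter :: "int \<Rightarrow> 'a \<Rightarrow> 'a" where
  "iter \<equiv> int_iterate X T"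

lemma compact_space: "compact X" and continuous_T: "continuous_on X T" and T_image: "T ` X \<subseteq> X"
  using inv_sys by (auto simp: invertible_system_def dynamical_system_def)

lemma inv_into_T:
  assumes "x \<in> X"
  shows "T (inv_into X T x) = x" "inv_into X T (T x) = x" "inv_into X T x \<in> X"
proof -
  obtain S where S: "homeomorphism X X T S" using inv_sys by (auto simp: invertible_system_def)
  have "inj_on T X" using homeomorphism_apply1[OF S] by (metis inj_onI)
  moreover have "x \<in> T ` X" using assms homeomorphism_image1[OF S] by simp
  ultimately show "T (inv_into X T x) = x" "inv_into X T (T x) = x" "inv_into X T x \<in> X"
    using assms by (simp_all add: f_inv_into_f inv_into_into)
qed

lemma continuous_inv_into_T: "continuous_on X (inv_into X T)"
proof -
  obtain S where S: "homeomorphism X X T S" using inv_sys by (auto simp: invertible_system_def)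
  have "inv_into X T x = S x" if "x \<in> X" for x
    using S that inv_into_T by (metis homeomorphism_apply1)
  then show ?thesis
    using S continuous_on_cong homeomorphism_cont2 by metis
qed

lemma iter_of_nat: "iter (int n) = T ^^ n"
  by (simp add: int_iterate_def)

lemma iter_mem: "x \<in> X \<Longrightarrow> iter n x \<in> X"
  using T_image inv_into_T(3) by (auto simp: int_iterate_def intro!: funpow_mem)

lemma continuous_iter: "continuous_on X (iter n)"
  using continuous_T T_image continuous_inv_into_T inv_into_T(3)
  by (auto simp: int_iterate_def intro!: continuous_on_funpow)

lemma iter_succ:
  assumes "x \<in> X"
  shows "iter (n + 1) x = T (iter n x)"
proof (cases "n \<ge> 0")
  case True
  then show ?thesis by (simp add: int_iterate_def nat_add_distrib)
next
  case False
  \<comment> \<open>With \<open>n = -(k + 1)\<close>, \<open>iter n\<close> applies the inverse once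
    more than \<open>iter (n + 1)\<close>, and \<open>T\<close> cancels that application.\<close>
  define k where "k = nat (- n - 1)"
  have n: "n = - int (Suc k)" using False by (simp add: k_def)
  have "iter (- int k) x = (inv_into X T ^^ k) x"
    by (simp add: int_iterate_def)
  moreover have "iter n x = inv_into X T ((inv_into X T ^^ k) x)"
    by (simp add: n int_iterate_def nat_add_distrib)
  moreover have "(inv_into X T ^^ k) x \<in> X"
    using assms inv_into_T(3) by (intro funpow_mem) auto
  ultimately show ?thesis by (simp add: n inv_into_T)
qed

lemma iter_add: "x \<in> X \<Longrightarrow> iter (m + n) x = iter m (iter n x)"
proof (induction m rule: int_induct[of _ 0])
  case base
  show ?case by (simp add: int_iterate_def)
next
  case (step1 i)
  then show ?case
    using iter_succ[of x "i + n"] iter_succ[of "iter n x" i] iter_mem by (simp add: algebra_simps)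
next
  case (step2 i)
  \<comment> \<open>Going downwards, the two sides are compared after applying \<open>T\<close>,
    which is then cancelled by its inverse on \<open>X\<close>.\<close>
  have "T (iter (i - 1 + n) x) = T (iter (i - 1) (iter n x))"
    using step2 iter_succ[of x "i - 1 + n"] iter_succ[of "iter n x" "i - 1"] iter_mem
    by (simp add: algebra_simps)
  then show ?case using inv_into_T(2) iter_mem step2.prems by metis
qed

lemma iter_comm: "x \<in> X \<Longrightarrow> iter m (iter n x) = iter n (iter m x)"
  by (metis add.commute iter_add)

lemma iter_uminus: "x \<in> X \<Longrightarrow> iter (- n) (iter n x) = x"
  using iter_add[of x "- n" n] by (simp add: int_iterate_def)

abbreviation iter2 :: "int \<Rightarrow> int \<Rightarrow> 'a \<times> 'a \<Rightarrow> 'a \<times> 'a" where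
  "iter2 a b \<equiv> map_prod (iter a) (iter b)"

lemma iter2_of_nat: "iter2 (int m) (int n) = map_prod (T ^^ m) (T ^^ n)"
  by (simp add: iter_of_nat)

lemma continuous_iter2: "continuous_on (X \<times> X) (iter2 a b)"
  unfolding map_prod_def case_prod_unfold
  by (intro continuous_on_Pair continuous_on_compose2[OF continuous_iter]
      continuous_on_fst continuous_on_snd continuous_on_id) auto

lemma iter2_image_add:
  "M \<subseteq> X \<times> X \<Longrightarrow> iter2 (a + c) (b + d) ` M = iter2 a b ` iter2 c d ` M"
  unfolding image_image by (intro image_cong) (auto simp: iter_add)

lemma iter2_image_uminus:
  assumes "M \<subseteq> X \<times> X" "iter2 a b ` M = M"
  shows "iter2 (- a) (- b) ` M = M"
proof -
  have "iter2 (- a) (- b) ` M = iter2 (- a) (- b) ` iter2 a b ` M" using assms(2) by simp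
  also have "\<dots> = iter2 0 0 ` M"
    using iter2_image_add[OF assms(1), of "- a" a "- b" b] by simp
  also have "\<dots> = M" by (simp add: int_iterate_def map_prod.id)
  finally show ?thesis .
qed

lemma iter2_image_mult:
  assumes "M \<subseteq> X \<times> X" "iter2 a b ` M = M"
  shows "iter2 (int k * a) (int k * b) ` M = M"
proof (induction k)
  case 0
  show ?case by (simp add: int_iterate_def map_prod.id)
next
  case (Suc k)
  then show ?case
    using iter2_image_add[OF assms(1), of a "int k * a" b "int k * b"] assms(2)
    by (simp add: algebra_simps)
qed

end

section \<open>POD systems\<close>

locale pod =
  fixes X :: "'a::metric_space set" and T :: "'a \<Rightarrow> 'a"
  assumes POD: "POD_system X T"
begin

sublocale homeomorphism_system X T
  using POD by unfold_locales (simp add: POD_system_def)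

lemma minimal_funpow: "n \<ge> 1 \<Longrightarrow> minimal_system X (T ^^ n)"
  using POD by (simp add: POD_system_def totally_minimal_def)

text \<open>Proximality gives close approaches at arbitrary times \<open>j\<close>. Waiting at most
  \<open>r\<close> further steps reaches a multiple of \<open>r\<close>, and equicontinuity keeps
  the points close meanwhile. The same \<open>n\<close> serves every \<open>e\<close>.\<close>

lemma approach_along_multiples:
  assumes "x \<in> X" "y \<in> X" "r \<ge> 1"
  shows "\<exists>n. \<forall>e>0. \<exists>k. dist ((T ^^ (r * k)) x) ((T ^^ (r * k)) (iter n y)) < e"
proof (cases "x = y")
  case True
  \<comment> \<open>The POD property speaks of distinct points only; for equal ones the zeroth power
    does.\<close>
  then show ?thesis by (intro exI[of _ 0]) (auto simp: int_iterate_def)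
next
  case False
  then obtain n where "proximal X T (iter n y) x"
    using POD assms by (auto simp: POD_system_def)
  then have prox: "\<And>e. e > 0 \<Longrightarrow> \<exists>j. dist ((T ^^ j) (iter n y)) ((T ^^ j) x) < e"
    by (auto simp: proximal_def Prox_def liminf_dist_eq_0_iff)
  have "\<exists>k. dist ((T ^^ (r * k)) x) ((T ^^ (r * k)) (iter n y)) < e" if "e > 0" for e
  proof -
    obtain d where d: "d > 0" "\<And>x y i. x \<in> X \<Longrightarrow> y \<in> X \<Longrightarrow> dist x y < d \<Longrightarrow> i \<le> r \<Longrightarrow>
        dist ((T ^^ i) x) ((T ^^ i) y) < e"
      using compact_funpow_equicontinuous[OF compact_space continuous_T T_image \<open>e > 0\<close>, of r] by blast
    obtain j where j: "dist ((T ^^ j) (iter n y)) ((T ^^ j) x) < d" using prox[OF d(1)] by blast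
    \<comment> \<open>The wait until the next multiple of \<open>r\<close> strictly after
      \<open>j\<close>; it equals \<open>r\<close> when \<open>r\<close> divides \<open>j\<close>,
      so the bound \<open>i \<le> r\<close> is attained.\<close>
    define i where "i = r - j mod r"
    have "j mod r < r" "r * (j div r) + j mod r = j" using \<open>r \<ge> 1\<close> by auto
    then have "r * (j div r + 1) = i + j"
      unfolding i_def distrib_left by linarith
    moreover have "dist ((T ^^ i) ((T ^^ j) x)) ((T ^^ i) ((T ^^ j) (iter n y))) < e"
      using j assms iter_mem T_image by (intro d(2)) (auto simp: dist_commute funpow_mem i_def)
    ultimately show ?thesis by (metis comp_apply funpow_add)
  qed
  then show ?thesis by blast
qed

text \<open>Total minimality concerns positive powers; invariance under both \<open>c\<close> and
  \<open>- c\<close> covers either sign.\<close>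

lemma iter_invariant_eq:
  assumes "c \<noteq> 0" "F \<subseteq> X" "closed F" "F \<noteq> {}" "iter c ` F \<subseteq> F" "iter (- c) ` F \<subseteq> F"
  shows "F = X"
proof (rule minimal_system_eqI[OF minimal_funpow])
  show "nat \<bar>c\<bar> \<ge> 1" using \<open>c \<noteq> 0\<close> by simp
  show "(T ^^ nat \<bar>c\<bar>) ` F \<subseteq> F"
    using assms(5,6) by (auto simp: abs_if simp flip: iter_of_nat split: if_splits)
qed fact+

lemma dvd_if_minimal_off_diagonal:
  assumes M: "minimal_system M (map_prod (T ^^ r) (T ^^ s))" and "M \<noteq> {}" and MX: "M \<subseteq> X \<times> X"
    and "r \<ge> 1" "s \<ge> 1" and off: "\<And>z. (z, z) \<notin> M"
  shows "r dvd s"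
proof -
  let ?S = "map_prod (T ^^ r) (T ^^ s)"
  have cM: "compact M" "?S ` M \<subseteq> M"
    using minimal_systemD[OF M] by blast+
  \<comment> \<open>Integer powers of \<open>T\<close> commute on \<open>X\<close>, so only the
    approach condition has to be checked for each pair of exponents.\<close>
  have stabI: "iter2 a b ` M = M"
    if "\<And>e. e > 0 \<Longrightarrow> \<exists>p\<in>M. \<exists>q\<in>M. dist p (iter2 a b q) < e" for a b
  proof (rule minimal_system_image_eq[OF M _ _ that])
    show "continuous_on M (iter2 a b)" using continuous_iter2 MX continuous_on_subset by blast
    show "?S (iter2 a b p) = iter2 a b (?S p)" if "p \<in> M" for p
      using that MX by (auto simp: iter_comm simp flip: iter_of_nat)
  qed auto
  \<comment> \<open>The projection is closed and invariant under \<open>T ^^ r\<close>. Its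
    surjectivity provides a point of \<open>M\<close> over \<open>T x\<close>.\<close>
  have fst_M: "fst ` M = X"
  proof (rule minimal_system_eqI[OF minimal_funpow[OF \<open>r \<ge> 1\<close>]])
    show "closed (fst ` M)"
      using cM(1) by (intro compact_imp_closed compact_continuous_image continuous_intros)
    show "(T ^^ r) ` fst ` M \<subseteq> fst ` M" using cM(2) by force
  qed (use MX \<open>M \<noteq> {}\<close> in auto)
  obtain x y where xy: "(x, y) \<in> M" using \<open>M \<noteq> {}\<close> by auto
  then have X: "x \<in> X" "y \<in> X" "T x \<in> X" using MX T_image by auto
  obtain y' where y': "(T x, y') \<in> M" using fst_M X(3) by force
  then have "y' \<in> X" using MX by auto
  obtain n where n: "\<And>e. e > 0 \<Longrightarrow> \<exists>k. dist ((T ^^ (s * k)) y) ((T ^^ (s * k)) (iter n y')) < e"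
    using approach_along_multiples[OF X(2) \<open>y' \<in> X\<close> \<open>s \<ge> 1\<close>] by blast
  have stab1: "iter2 (- 1) n ` M = M"
  proof (rule stabI)
    fix e :: real assume "e > 0"
    then obtain k where k: "dist ((T ^^ (s * k)) y) ((T ^^ (s * k)) (iter n y')) < e" using n by blast
    \<comment> \<open>The first coordinates of \<open>p\<close> and \<open>q\<close> differ by
      exactly one \<open>T\<close> at every time \<open>k\<close>. After
      \<open>iter2 (- 1) n\<close> they agree, so only the second coordinates contribute to the
      distance.\<close>
    define p where "p = (?S ^^ k) (x, y)"
    define q where "q = (?S ^^ k) (T x, y')"
    have "p \<in> M" "q \<in> M" unfolding p_def q_def using funpow_mem[OF cM(2)] xy y' by auto
    have p: "p = ((T ^^ (r * k)) x, (T ^^ (s * k)) y)"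
      by (simp add: p_def map_prod_funpow funpow_mult)
    have "(T ^^ (r * k)) (T x) = iter 1 ((T ^^ (r * k)) x)"
      using iter_of_nat[of 1] by (simp add: funpow_swap1)
    then have "iter (- 1) ((T ^^ (r * k)) (T x)) = (T ^^ (r * k)) x"
      using iter_uminus[of _ 1] funpow_mem[OF T_image X(1)] by simp
    moreover have "iter n ((T ^^ (s * k)) y') = (T ^^ (s * k)) (iter n y')"
      using iter_comm[OF \<open>y' \<in> X\<close>] by (simp flip: iter_of_nat)
    ultimately have "iter2 (- 1) n q = ((T ^^ (r * k)) x, (T ^^ (s * k)) (iter n y'))"
      by (simp add: q_def map_prod_funpow funpow_mult)
    then have "dist p (iter2 (- 1) n q) < e" using k p by (simp add: dist_Pair_Pair)
    then show "\<exists>p\<in>M. \<exists>q\<in>M. dist p (iter2 (- 1) n q) < e" using \<open>p \<in> M\<close> \<open>q \<in> M\<close> by blast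
  qed
  have stab2: "iter2 (int r) (int s) ` M = M"
  proof (rule stabI)
    fix e :: real assume "e > 0"
    then show "\<exists>p\<in>M. \<exists>q\<in>M. dist p (iter2 (int r) (int s) q) < e"
      using xy cM(2) unfolding iter2_of_nat
      by (intro bexI[of _ "?S (x, y)"] bexI[of _ "(x, y)"]) auto
  qed
  \<comment> \<open>The \<open>r\<close>-th power of the exponent pair \<open>(-1, n)\<close> added
    to \<open>(r, s)\<close> cancels the first exponent and leaves \<open>c\<close> in the
    second.\<close>
  define c where "c = int r * n + int s"
  have stab: "iter2 0 c ` M = M"
    using iter2_image_add[OF MX, of "int r * (- 1)" "int r" "int r * n" "int s"]
      iter2_image_mult[OF MX stab1, of r] stab2 by (simp add: c_def)
  have "c = 0"
  proof (rule ccontr)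
    assume "c \<noteq> 0"
    \<comment> \<open>The fibre of \<open>M\<close> over \<open>x\<close>, preserved by
      \<open>iter c\<close> and its inverse. If it is all of \<open>X\<close>, it contains
      \<open>x\<close>, which puts \<open>(x, x)\<close> in \<open>M\<close>.\<close>
    let ?F = "snd ` (M \<inter> ({x} \<times> X))"
    have inv: "iter d ` ?F \<subseteq> ?F" if "iter2 0 d ` M = M" for d
    proof
      fix w assume "w \<in> iter d ` ?F"
      then obtain v where v: "(x, v) \<in> M" "w = iter d v" by auto
      then have "iter2 0 d (x, v) \<in> M" using that by blast
      then have "(x, w) \<in> M" using v(2) by (simp add: int_iterate_def)
      then show "w \<in> ?F" using MX by force
    qed
    have "?F = X"
    proof (rule iter_invariant_eq[OF \<open>c \<noteq> 0\<close>])
      have "compact (M \<inter> ({x} \<times> X))"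
        using cM(1) compact_space by (intro compact_Int compact_Times) auto
      then show "closed ?F"
        by (intro compact_imp_closed compact_continuous_image continuous_intros)
      show "?F \<noteq> {}" using xy X by auto
      show "iter c ` ?F \<subseteq> ?F" using inv stab by blast
      show "iter (- c) ` ?F \<subseteq> ?F"
        using inv iter2_image_uminus[OF MX stab] by simp
    qed auto
    then have "(x, x) \<in> M" using X(1) by force
    then show False using off by blast
  qed
  then have "int s = int r * (- n)" by (simp add: c_def)
  then show ?thesis by (metis dvd_triv_left int_dvd_int_iff)
qed

lemma minimal_meets_diagonal:
  assumes M: "minimal_system M (map_prod (T ^^ r) (T ^^ s))" and "M \<noteq> {}" and MX: "M \<subseteq> X \<times> X"
    and "r \<ge> 1" "s \<ge> 1" "r \<noteq> s"
  shows "\<exists>z. (z, z) \<in> M"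
proof (rule ccontr)
  assume off: "\<nexists>z. (z, z) \<in> M"
  then have "r dvd s" using dvd_if_minimal_off_diagonal assms by blast
  moreover have "s dvd r"
    using off assms by (intro dvd_if_minimal_off_diagonal[OF minimal_system_swap[OF M]]) auto
  ultimately show False using \<open>r \<noteq> s\<close> dvd_antisym by blast
qed

text \<open>The orbit closure of \<open>(x, y)\<close> contains a minimal set, hence a diagonal
  point \<open>(z, z)\<close>. An orbit point within \<open>e / 2\<close> of it has both coordinates
  within \<open>e / 2\<close> of \<open>z\<close>.\<close>

lemma orbit_near_diagonal:
  assumes "x \<in> X" "y \<in> X" "r \<ge> 1" "s \<ge> 1" "r \<noteq> s" "e > 0"
  shows "\<exists>n. dist ((T ^^ (r * n)) x) ((T ^^ (s * n)) y) < e"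
proof -
  let ?S = "map_prod (T ^^ r) (T ^^ s)"
  define Q where "Q = range (\<lambda>n. (?S ^^ n) (x, y))"
  have contS: "continuous_on (X \<times> X) ?S"
    using continuous_iter2 by (simp flip: iter2_of_nat)
  have "?S ` (X \<times> X) \<subseteq> X \<times> X" using funpow_mem[OF T_image] by auto
  then have "Q \<subseteq> X \<times> X"
    unfolding Q_def using assms(1,2) by (intro image_subsetI funpow_mem) auto
  moreover have cXX: "compact (X \<times> X)" using compact_space by (intro compact_Times)
  ultimately have QX: "closure Q \<subseteq> X \<times> X" by (intro closure_minimal compact_imp_closed)
  have contQ: "continuous_on (closure Q) ?S" using contS QX continuous_on_subset by blast
  have "?S p \<in> Q" if "p \<in> Q" for p
  proof -
    obtain n where "p = (?S ^^ n) (x, y)" using \<open>p \<in> Q\<close> by (auto simp: Q_def)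
    then have "?S p = (?S ^^ Suc n) (x, y)" by simp
    then show ?thesis unfolding Q_def by blast
  qed
  then have "?S ` Q \<subseteq> Q" by (rule image_subsetI)
  then have "?S ` Q \<subseteq> closure Q" using closure_subset by (rule subset_trans)
  then have invQ: "?S ` closure Q \<subseteq> closure Q"
    by (rule image_closure_subset[OF contQ closed_closure])
  have "compact (closure Q)"
    using QX cXX by (metis closed_closure compact_Int_closed inf.absorb2)
  then have "dynamical_system (closure Q) ?S"
    unfolding dynamical_system_def image_subset_iff_funcset[symmetric] using contQ invQ by simp
  moreover have "closure Q \<noteq> {}" by (simp add: Q_def)
  ultimately obtain M where "M \<subseteq> closure Q" "M \<noteq> {}" "minimal_system M ?S"
    using exists_minimal_subsystem by blast
  then obtain z where "(z, z) \<in> closure Q"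
    using minimal_meets_diagonal QX assms by blast
  then obtain p where "p \<in> Q" "dist p (z, z) < e / 2"
    using \<open>e > 0\<close> closure_approachable half_gt_zero by blast
  then obtain n where n: "dist ((T ^^ (r * n)) x, (T ^^ (s * n)) y) (z, z) < e / 2"
    by (auto simp: Q_def map_prod_funpow funpow_mult)
  have "dist ((T ^^ (r * n)) x) z < e / 2" "dist ((T ^^ (s * n)) y) z < e / 2"
    using n dist_fst_le dist_snd_le by (metis fst_conv le_less_trans, metis snd_conv le_less_trans)
  then have "dist ((T ^^ (r * n)) x) ((T ^^ (s * n)) y) < e" using dist_triangle_half_l by blast
  then show ?thesis by blast
qed

end

theorem proposition6p13:
  fixes X :: "'a::metric_space set" and T :: "'a \<Rightarrow> 'a" and r s :: nat
  assumes "POD_system X T"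
    and "r \<ge> 1" and "s \<ge> 1" and "r \<noteq> s"
  shows "Prox X T r s = X \<times> X"
proof -
  interpret pod X T by unfold_locales fact
  have "\<exists>n\<ge>N. dist ((T ^^ (r * n)) x) ((T ^^ (s * n)) y) < e"
    if xy: "x \<in> X" "y \<in> X" and "e > 0" for x y e N
  proof -
    \<comment> \<open>Starting from the pair at time \<open>N\<close> turns some close approach into
      one at time \<open>n + N\<close>, which is at least \<open>N\<close>.\<close>
    obtain n where "dist ((T ^^ (r * n)) ((T ^^ (r * N)) x)) ((T ^^ (s * n)) ((T ^^ (s * N)) y)) < e"
      using orbit_near_diagonal[of "(T ^^ (r * N)) x" "(T ^^ (s * N)) y"] funpow_mem[OF T_image]
        xy assms(2-4) \<open>e > 0\<close> by blast
    then have "dist ((T ^^ (r * (n + N))) x) ((T ^^ (s * (n + N))) y) < e"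
      by (simp add: funpow_add distrib_left)
    then show ?thesis using le_add2 by blast
  qed
  then show ?thesis by (auto simp: Prox_def liminf_dist_eq_0_iff)
qed

end
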